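(* Let $D$ be a link diagram with $N$ crossings. (+) If $D$ is $+$-adequate and the graph $G_{s_+}(D)$ has a cycle of odd length, then the Khovanov homology of $D$ has $\mathbb{Z}_2$ torsion; more precisely, $H_{N-2,\,N+2|s_+|-4}(D)$ has $\mathbb{Z}_2$ torsion (contains a subgroup isomorphic to $\mathbb{Z}_2=\mathbb{Z}/2$). (−) If $D$ is $-$-adequate and the graph $G_{s_-}(D)$ has a cycle of odd length, then $H_{-N,\,-N-2|s_-|+4}(D)$ has $\mathbb{Z}_2$ torsion.
   Context: Khovanov homology (framed unoriented version). A link diagram $D$ is a diagram on the disc of an unoriented framed link in the 3-ball. A Kauffman state $s$ of $D$ assigns to each crossing a marker $+1$ or $-1$. The smoothing of a crossing given by a positive marker joins the two regions swept out when the over-strand is rotated counterclockwise towards the under-strand (Kauffman's $A$-smoothing); a negative marker gives the other smoothing. $D_s$ is the system of circles obtained by smoothing all crossings according to $s$, $|s|$ is the number of circles of $D_s$, and $\sigma(s)$ is the number of positive markers minus the number of negative markers. $s_+$ (resp. $s_-$) is the state with all markers positive (resp. negative). An enhanced state $S$ is a Kauffman state $s$ with a sign $+$ or $-$ assigned to each circle of $D_s$; $D_S=D_s$, $\sigma(S)=\sigma(s)$, and $\tau(S)$ is the number of positive circles minus the number of negative circles. $\mathcal{C}_{i,j}(D)$ is the free abelian group on the enhanced states $S$ with $\sigma(S)=i$ and $\sigma(S)+2\tau(S)=j$. After ordering the crossings, $d_{i,j}:\mathcal{C}_{i,j}(D)\to\mathcal{C}_{i-2,j}(D)$ is $d(S)=\sum_{S'}(-1)^{t(S:S')}[S:S']S'$,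 summed over enhanced states $S'$ generating $\mathcal{C}_{i-2,j}(D)$, where $[S:S']=1$ if the markers of $S$ and $S'$ differ at exactly one crossing $c$ and all circles of $D_S$ and $D_{S'}$ not touching $c$ have the same signs in $S$ and $S'$, and $[S:S']=0$ otherwise; $t(S:S')$ is the number of negative markers of $S$ at crossings bigger than $c$. $H_{i,j}(D)=\ker(d_{i,j})/d_{i+2,j}(\mathcal{C}_{i+2,j}(D))$. Graphs. For a Kauffman state $s$, $G_s(D)$ is the graph whose vertices are the circles of $D_s$ and whose edges are in bijection with the crossings of $D$, the edge of a crossing connecting the circle(s) of $D_s$ touching at that crossing. $D$ is $+$-adequate (resp. $-$-adequate) if $G_{s_+}(D)$ (resp. $G_{s_-}(D)$) has no loops. *)

theory Defs
  imports "HOL-Algebra.Algebra" "HOL-Combinatorics.Orbits"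
begin

section \<open>Link diagrams\<close>

text \<open>
  An unoriented link diagram is encoded as a planar diagram (PD) code.  The four ends of arcs at a
  crossing \<open>c\<close> are the darts \<open>(c, 0)\<close>, \<open>(c, 1)\<close>, \<open>(c, 2)\<close>, \<open>(c, 3)\<close>, listed counterclockwise,
  such that the under-strand is \<open>0 - 2\<close> and the over-strand is \<open>1 - 3\<close>.  The involution \<open>glue\<close> sends
  a dart to the other end of its arc, and \<open>free_circles\<close> counts the components of the diagram
  without any crossing.  The framing is the blackboard framing, so it carries no extra data.
\<close>

record 'c diagram =
  crossings :: "'c set"
  glue :: "'c \<times> nat \<Rightarrow> 'c \<times> nat"
  free_circles :: nat

definition darts :: "'c diagram \<Rightarrow> ('c \<times> nat) set" where
  "darts D = crossings D \<times> {0..<4}"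

fun rot :: "'c \<times> nat \<Rightarrow> 'c \<times> nat" where
  "rot (c, k) = (c, (k + 1) mod 4)"

text \<open>
  The boundary of a face is traced by following an arc to its other end and turning to the next
  dart there.
\<close>

definition faces :: "'c diagram \<Rightarrow> ('c \<times> nat) set set" where
  "faces D = orbit (rot \<circ> glue D) ` darts D"

definition components :: "'c diagram \<Rightarrow> ('c \<times> nat) set set" where
  "components D =
     darts D // ({(x, glue D x) | x. x \<in> darts D} \<union> {(x, rot x) | x. x \<in> darts D})\<^sup>*"

text \<open>
  A diagram with crossing set of size \<open>V\<close> has \<open>2 V\<close> arcs.  Each connected component of the underlying
  4-valent ribbon graph has Euler characteristic at most 2, with equality iff it has genus 0; hence
  \<open>V - 2 V + F = 2 * (number of components)\<close> says that the code is drawn in the plane (it excludes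
  virtual diagrams).
\<close>

definition link_diagram :: "'c diagram \<Rightarrow> bool" where
  "link_diagram D \<longleftrightarrow>
     finite (crossings D) \<and>
     (\<forall>x\<in>darts D. glue D x \<in> darts D \<and> glue D x \<noteq> x \<and> glue D (glue D x) = x) \<and>
     card (faces D) = card (crossings D) + 2 * card (components D)"


section \<open>Kauffman states\<close>

definition kauffman_states :: "'c diagram \<Rightarrow> ('c \<Rightarrow> int) set" where
  "kauffman_states D = crossings D \<rightarrow>\<^sub>E {1, -1}"

definition state_plus :: "'c diagram \<Rightarrow> 'c \<Rightarrow> int" where
  "state_plus D = (\<lambda>c\<in>crossings D. 1)"

definition state_minus :: "'c diagram \<Rightarrow> 'c \<Rightarrow> int" where
  "state_minus D = (\<lambda>c\<in>crossings D. -1)"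

definition sigma :: "'c diagram \<Rightarrow> ('c \<Rightarrow> int) \<Rightarrow> int" where
  "sigma D s = int (card {c \<in> crossings D. s c = 1}) - int (card {c \<in> crossings D. s c = -1})"

text \<open>
  Rotating the over-strand \<open>1 - 3\<close> counterclockwise towards the under-strand sweeps out the region
  between the ends 1 and 2 and the region between the ends 3 and 0.  Joining these two regions
  leaves the arcs \<open>0 - 1\<close> and \<open>2 - 3\<close>.
\<close>

definition smoothing_arcs :: "int \<Rightarrow> (nat \<times> nat) set" where
  "smoothing_arcs m =
     (if m = 1 then {(0, 1), (1, 0), (2, 3), (3, 2)} else {(1, 2), (2, 1), (3, 0), (0, 3)})"

definition smoothed :: "'c diagram \<Rightarrow> ('c \<Rightarrow> int) \<Rightarrow> (('c \<times> nat) \<times> ('c \<times> nat)) set" where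
  "smoothed D s =
     {(x, glue D x) | x. x \<in> darts D} \<union>
     {((c, k), (c, l)) | c k l. c \<in> crossings D \<and> (k, l) \<in> smoothing_arcs (s c)}"

text \<open>
  A circle of \<open>D\<^sub>s\<close> is either the set of darts it runs through, or one of the components of the
  diagram without crossings.
\<close>

type_synonym 'c circle = "('c \<times> nat) set + nat"

definition circles :: "'c diagram \<Rightarrow> ('c \<Rightarrow> int) \<Rightarrow> 'c circle set" where
  "circles D s = Inl ` (darts D // (smoothed D s)\<^sup>*) \<union> Inr ` {0..<free_circles D}"

definition touches :: "'c circle \<Rightarrow> 'c \<Rightarrow> bool" where
  "touches C c \<longleftrightarrow> (\<exists>A k. C = Inl A \<and> (c, k) \<in> A)"


section \<open>State graphs and adequacy\<close>

text \<open>
  Undirected multigraphs, with loops allowed.  The set of ends of an edge has two elements, or one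
  element if the edge is a loop.
\<close>

record ('v, 'e) multigraph =
  verts :: "'v set"
  edges :: "'e set"
  ends :: "'e \<Rightarrow> 'v set"

definition has_no_loops :: "('v, 'e) multigraph \<Rightarrow> bool" where
  "has_no_loops G \<longleftrightarrow> \<not> (\<exists>e\<in>edges G. \<exists>v\<in>verts G. ends G e = {v})"

definition is_cycle :: "('v, 'e) multigraph \<Rightarrow> 'v list \<Rightarrow> 'e list \<Rightarrow> bool" where
  "is_cycle G vs es \<longleftrightarrow>
     es \<noteq> [] \<and> length vs = length es \<and> distinct vs \<and> distinct es \<and>
     set vs \<subseteq> verts G \<and> set es \<subseteq> edges G \<and>
     (\<forall>i<length es. ends G (es ! i) = {vs ! i, vs ! ((i + 1) mod length vs)})"

definition has_odd_cycle :: "('v, 'e) multigraph \<Rightarrow> bool" where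
  "has_odd_cycle G \<longleftrightarrow> (\<exists>vs es. is_cycle G vs es \<and> odd (length es))"

definition state_graph :: "'c diagram \<Rightarrow> ('c \<Rightarrow> int) \<Rightarrow> ('c circle, 'c) multigraph" where
  "state_graph D s =
     \<lparr>verts = circles D s, edges = crossings D, ends = (\<lambda>c. {C \<in> circles D s. touches C c})\<rparr>"

definition plus_adequate :: "'c diagram \<Rightarrow> bool" where
  "plus_adequate D \<longleftrightarrow> has_no_loops (state_graph D (state_plus D))"

definition minus_adequate :: "'c diagram \<Rightarrow> bool" where
  "minus_adequate D \<longleftrightarrow> has_no_loops (state_graph D (state_minus D))"


section \<open>Khovanov homology\<close>

type_synonym 'c enhanced_state = "('c \<Rightarrow> int) \<times> ('c circle \<Rightarrow> int)"

definition enhanced_states :: "'c diagram \<Rightarrow> 'c enhanced_state set" where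
  "enhanced_states D = (SIGMA s:kauffman_states D. circles D s \<rightarrow>\<^sub>E {1, -1})"

definition tau :: "'c diagram \<Rightarrow> 'c enhanced_state \<Rightarrow> int" where
  "tau D S = int (card {C \<in> circles D (fst S). snd S C = 1})
           - int (card {C \<in> circles D (fst S). snd S C = -1})"

definition generators :: "'c diagram \<Rightarrow> int \<Rightarrow> int \<Rightarrow> 'c enhanced_state set" where
  "generators D i j =
     {S \<in> enhanced_states D. sigma D (fst S) = i \<and> sigma D (fst S) + 2 * tau D S = j}"

definition chain_group :: "'c diagram \<Rightarrow> int \<Rightarrow> int \<Rightarrow> ('c enhanced_state \<Rightarrow>\<^sub>0 int) monoid" where
  "chain_group D i j = free_Abelian_group (generators D i j)"

definition differ_only_at ::
    "'c diagram \<Rightarrow> 'c enhanced_state \<Rightarrow> 'c enhanced_state \<Rightarrow> 'c \<Rightarrow> bool" where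
  "differ_only_at D S S' c \<longleftrightarrow> {c' \<in> crossings D. fst S c' \<noteq> fst S' c'} = {c}"

text \<open>
  A circle not touching \<open>c\<close> belongs to the first smoothing iff it belongs to the second, being the
  same set of darts in both.
\<close>

definition incidence :: "'c diagram \<Rightarrow> 'c enhanced_state \<Rightarrow> 'c enhanced_state \<Rightarrow> int" where
  "incidence D S S' =
     (if \<exists>c. differ_only_at D S S' c \<and>
             (\<forall>C \<in> circles D (fst S) \<union> circles D (fst S'). \<not> touches C c \<longrightarrow> snd S C = snd S' C)
      then 1 else 0)"

text \<open>
  The sign exponent is only relevant for nonzero incidence, where the crossing at which the two
  states differ is unique.  The ordering of the crossings is the one of the type \<open>'c\<close>.
\<close>

definition sign_exponent ::
    "('c :: linorder) diagram \<Rightarrow> 'c enhanced_state \<Rightarrow> 'c enhanced_state \<Rightarrow> nat" where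
  "sign_exponent D S S' =
     card {c' \<in> crossings D. fst S c' = -1 \<and> (THE c. differ_only_at D S S' c) < c'}"

definition differential ::
    "('c :: linorder) diagram \<Rightarrow> int \<Rightarrow> int \<Rightarrow> ('c enhanced_state \<Rightarrow>\<^sub>0 int) \<Rightarrow> ('c enhanced_state \<Rightarrow>\<^sub>0 int)"
  where
  "differential D i j =
     frag_extend (\<lambda>S. \<Sum>S'\<in>generators D (i - 2) j.
       frag_cmul ((-1) ^ sign_exponent D S S' * incidence D S S') (frag_of S'))"

definition khovanov_homology ::
    "('c :: linorder) diagram \<Rightarrow> int \<Rightarrow> int \<Rightarrow> ('c enhanced_state \<Rightarrow>\<^sub>0 int) set monoid" where
  "khovanov_homology D i j =
     subgroup_generated (chain_group D i j)
       (kernel (chain_group D i j) (chain_group D (i - 2) j) (differential D i j))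
     Mod (differential D (i + 2) j ` carrier (chain_group D (i + 2) j))"

definition has_Z2_torsion :: "'a monoid \<Rightarrow> bool" where
  "has_Z2_torsion G \<longleftrightarrow> (\<exists>K. subgroup K G \<and> subgroup_generated G K \<cong> integer_mod_group 2)"

end

theory Submission
  imports Defs "HOL-Library.Disjoint_Sets" "HOL-Library.Z2"
begin

text \<open>
  In the quantum degree of the theorem, the Khovanov complex near the extreme state is the incidence
  matrix of the state graph, and an odd cycle of a graph gives 2-torsion in the cokernel of its unsigned
  incidence matrix.

  Let all markers be equal to \<open>m\<close>, and let \<open>n\<close> be the number of circles of this state.  In quantum degree
  \<open>m (N + 2 n - 4)\<close> an enhanced state of this Kauffman state has exactly one circle of sign \<open>-m\<close>, so these
  generators are the vertices of the state graph (\<open>vertex_generators\<close>).  If one marker is changed, two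
  circles merge, because the graph has no loops, and the degree forces all signs to be \<open>m\<close>; so these
  generators are the edges (\<open>edge_generators\<close>).  A vertex and an edge are incident in the complex exactly
  if they are incident in the graph (\<open>incidence_vertex_edge\<close>).  The geometric input is that
  a changed marker merges two different circles (\<open>touching_merge\<close>) and creates at most one
  (\<open>card_circles_le\<close>).

  For \<open>m = 1\<close> the differential maps a vertex to the sum of its incident edges.  The sum of all
  edges is a cycle, because the two orders in which a pair of markers can be changed contribute opposite
  signs, and twice it is the boundary of the sum of all vertices.  If it were itself a
  boundary, there would be integers \<open>f v\<close> with \<open>f v + f w = 1\<close> for every edge \<open>v w\<close>, whose parities would
  be a 2-colouring of the graph; an odd cycle excludes this.

  For \<open>m = -1\<close> the arrows are reversed: an edge \<open>v w\<close> is mapped to \<open>v + w\<close> up to sign, and every vertex is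
  a cycle.  Going around an odd cycle, each vertex is homologous to the negative of the next
  one, so twice a vertex on it is a boundary.  The vertex itself is not, since boundaries have an even
  coefficient sum.

  Both uses of the odd cycle are the telescoping sum \<open>odd_cycle_alternating_sum\<close>.
\<close>

section \<open>Circles of a state and the change of one marker\<close>

text \<open>
  Counting modulo 2 with coefficients in the two-element field \<^typ>\<open>bit\<close>, the two elements of each
  orbit cancel.
\<close>

lemma even_card_fixpoint_free_involution:
  assumes "\<And>x. x \<in> A \<Longrightarrow> h x \<in> A" "\<And>x. x \<in> A \<Longrightarrow> h (h x) = x" "\<And>x. x \<in> A \<Longrightarrow> h x \<noteq> x"
  shows "even (card A)"
proof -
  have "(\<Sum>x\<in>A. 1 :: bit) = 0"
    by (rule sum_involution_eq_0[of A _ h]) (use assms in auto)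
  then have "(of_nat (card A) :: bit) = 0" by simp
  moreover have "(of_nat n :: bit) = of_bool (odd n)" for n by (induction n) auto
  ultimately show ?thesis by (simp split: if_splits)
qed

definition circle_of :: "'c diagram \<Rightarrow> ('c \<Rightarrow> int) \<Rightarrow> 'c \<times> nat \<Rightarrow> ('c \<times> nat) set" where
  "circle_of D s x = (smoothed D s)\<^sup>* `` {x}"

definition touching :: "'c diagram \<Rightarrow> ('c \<Rightarrow> int) \<Rightarrow> 'c \<Rightarrow> 'c circle set" where
  "touching D s c = {C \<in> circles D s. touches C c}"

text \<open>
  In the smoothing with marker \<open>m\<close>, the end \<open>k\<close> of a crossing is joined to \<open>opposite_end m k\<close>.  Writing
  the smoothing as an involution makes the parity argument of \<open>touching_merge\<close> possible.
\<close>

definition opposite_end :: "int \<Rightarrow> nat \<Rightarrow> nat" where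
  "opposite_end m k = (if m = 1 then (if even k then k + 1 else k - 1) else 3 - k)"

lemma less_4_cases: "(k::nat) < 4 \<longleftrightarrow> k = 0 \<or> k = 1 \<or> k = 2 \<or> k = 3"
  by auto

lemma smoothing_arcs_iff:
  "(k, l) \<in> smoothing_arcs m \<longleftrightarrow> k < 4 \<and> l = opposite_end m k"
  unfolding less_4_cases by (auto simp: smoothing_arcs_def opposite_end_def)

lemma opposite_end:
  assumes "k < 4"
  shows "opposite_end m k < 4" "opposite_end m (opposite_end m k) = k" "opposite_end m k \<noteq> k"
  using assms unfolding less_4_cases by (auto simp: opposite_end_def)

lemma in_darts_iff: "(c, k) \<in> darts D \<longleftrightarrow> c \<in> crossings D \<and> k < 4"
  by (auto simp: darts_def)

lemma smoothed_iff:
  "(x, y) \<in> smoothed D s \<longleftrightarrow>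
     x \<in> darts D \<and> (y = glue D x \<or> y = (fst x, opposite_end (s (fst x)) (snd x)))"
  by (cases x) (auto simp: smoothed_def smoothing_arcs_iff in_darts_iff)

context
  fixes D :: "'c diagram"
  assumes D: "link_diagram D"
begin

lemma finite_crossings: "finite (crossings D)"
  using D by (simp add: link_diagram_def)

lemma finite_darts: "finite (darts D)"
  using finite_crossings by (simp add: darts_def)

lemma glue_dart:
  assumes "x \<in> darts D"
  shows "glue D x \<in> darts D" "glue D x \<noteq> x" "glue D (glue D x) = x"
  using D assms by (auto simp: link_diagram_def)

lemma smoothed_in_darts: "(x, y) \<in> smoothed D s \<Longrightarrow> x \<in> darts D \<and> y \<in> darts D"
  by (cases x) (auto simp: smoothed_iff glue_dart in_darts_iff opposite_end)

lemma sym_smoothed: "sym (smoothed D s)"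
proof (rule symI)
  fix x y assume "(x, y) \<in> smoothed D s"
  then show "(y, x) \<in> smoothed D s"
    using smoothed_in_darts[of x y s]
    by (cases x; cases y) (auto simp: smoothed_iff glue_dart in_darts_iff opposite_end)
qed

lemma connected_sym: "(x, y) \<in> (smoothed D s)\<^sup>* \<Longrightarrow> (y, x) \<in> (smoothed D s)\<^sup>*"
  using sym_rtrancl[OF sym_smoothed] by (rule symD)

lemma circle_of_eq_iff: "circle_of D s x = circle_of D s y \<longleftrightarrow> (x, y) \<in> (smoothed D s)\<^sup>*"
proof
  assume "circle_of D s x = circle_of D s y"
  then show "(x, y) \<in> (smoothed D s)\<^sup>*" by (auto simp: circle_of_def)
next
  assume "(x, y) \<in> (smoothed D s)\<^sup>*"
  with connected_sym[OF this] show "circle_of D s x = circle_of D s y"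
    unfolding circle_of_def by (blast intro: rtrancl_trans)
qed

lemma circle_of_refl: "x \<in> circle_of D s x"
  by (simp add: circle_of_def)

lemma circle_of_eqI: "y \<in> circle_of D s x \<Longrightarrow> circle_of D s y = circle_of D s x"
  by (simp add: circle_of_eq_iff) (simp add: circle_of_def connected_sym)

lemma circle_of_subset_darts: "x \<in> darts D \<Longrightarrow> circle_of D s x \<subseteq> darts D"
proof
  fix y assume x: "x \<in> darts D" and "y \<in> circle_of D s x"
  then have "(x, y) \<in> (smoothed D s)\<^sup>*" by (simp add: circle_of_def)
  then show "y \<in> darts D" using x smoothed_in_darts by (induction) auto
qed

lemma circles_eq: "circles D s = Inl ` circle_of D s ` darts D \<union> Inr ` {0..<free_circles D}"
  by (auto simp: circles_def quotient_def circle_of_def)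

lemma finite_circles: "finite (circles D s)"
  using finite_darts by (simp add: circles_eq)

lemma finite_touching: "finite (touching D s c)"
  using finite_circles by (simp add: touching_def)

lemma smoothed_other_crossing:
  assumes "\<forall>c'\<in>crossings D - {c}. s c' = s' c'" "(x, y) \<in> smoothed D s" "fst x \<noteq> c"
  shows "(x, y) \<in> smoothed D s'"
  using assms by (cases x) (auto simp: smoothed_iff in_darts_iff)

text \<open>
  A path that never meets the crossing \<open>c\<close> does not see the marker at \<open>c\<close>.  Both inclusions follow the
  path step by step and use that all of its darts lie on the circle of \<open>s\<close>, away from \<open>c\<close>.
\<close>

lemma circle_of_away_from_crossing:
  assumes agree: "\<forall>c'\<in>crossings D - {c}. s c' = s' c'"
    and away: "\<And>k. (c, k) \<notin> circle_of D s x"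
  shows "circle_of D s' x = circle_of D s x"
proof
  have away': "fst y \<noteq> c" if "y \<in> circle_of D s x" for y
    using away that by (cases y) auto
  show "circle_of D s x \<subseteq> circle_of D s' x"
  proof
    fix y assume "y \<in> circle_of D s x"
    then have "(x, y) \<in> (smoothed D s)\<^sup>*" by (simp add: circle_of_def)
    then show "y \<in> circle_of D s' x"
    proof induction
      case (step y z)
      then have "(y, z) \<in> smoothed D s'"
        using smoothed_other_crossing[OF agree] away' by (auto simp: circle_of_def)
      with step.IH show ?case by (auto simp: circle_of_def)
    qed (simp add: circle_of_refl)
  qed
  show "circle_of D s' x \<subseteq> circle_of D s x"
  proof
    fix y assume "y \<in> circle_of D s' x"
    then have "(x, y) \<in> (smoothed D s')\<^sup>*" by (simp add: circle_of_def)
    then show "y \<in> circle_of D s x"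
    proof induction
      case (step y z)
      then have "(y, z) \<in> smoothed D s"
        using smoothed_other_crossing[of c s' s y z] agree away' by auto
      with step.IH show ?case by (auto simp: circle_of_def)
    qed (simp add: circle_of_refl)
  qed
qed

lemma circles_away_from_crossing:
  assumes agree: "\<forall>c'\<in>crossings D - {c}. s c' = s' c'"
    and "C \<in> circles D s" "\<not> touches C c"
  shows "C \<in> circles D s'"
proof (cases C)
  case (Inl A)
  then obtain x where "x \<in> darts D" "A = circle_of D s x" using assms(2) by (auto simp: circles_eq)
  moreover have "circle_of D s' x = circle_of D s x"
    by (rule circle_of_away_from_crossing[OF agree])
      (use assms(3) Inl \<open>A = circle_of D s x\<close> in \<open>auto simp: touches_def\<close>)
  ultimately show ?thesis by (auto simp: circles_eq Inl)
qed (use assms(2) in \<open>auto simp: circles_eq\<close>)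

lemma circle_of_opposite_end:
  assumes "c \<in> crossings D" "k < 4"
  shows "circle_of D s (c, opposite_end (s c) k) = circle_of D s (c, k)"
proof (rule circle_of_eqI)
  have "((c, k), (c, opposite_end (s c) k)) \<in> smoothed D s"
    using assms by (simp add: smoothed_iff in_darts_iff)
  then show "(c, opposite_end (s c) k) \<in> circle_of D s (c, k)"
    unfolding circle_of_def Image_singleton_iff by (rule r_into_rtrancl)
qed

text \<open>
  Each of the two arcs that replace a crossing has exactly one of the ends \<open>0\<close> and \<open>2\<close>, whichever the
  marker is.
\<close>

lemma touching_eq:
  assumes c: "c \<in> crossings D"
  shows "touching D s c = {Inl (circle_of D s (c, 0)), Inl (circle_of D s (c, 2))}"
proof (intro subset_antisym subsetI)
  have "opposite_end (s c) 0 = 1 \<and> opposite_end (s c) 2 = 3 \<or>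
      opposite_end (s c) 0 = 3 \<and> opposite_end (s c) 2 = 1"
    by (simp add: opposite_end_def)
  then have "circle_of D s (c, 1) \<in> {circle_of D s (c, 0), circle_of D s (c, 2)}"
    and "circle_of D s (c, 3) \<in> {circle_of D s (c, 0), circle_of D s (c, 2)}"
    using circle_of_opposite_end[OF c, of 0 s] circle_of_opposite_end[OF c, of 2 s] by auto
  then have ends: "circle_of D s (c, k) \<in> {circle_of D s (c, 0), circle_of D s (c, 2)}"
    if "k < 4" for k
    using that unfolding less_4_cases by auto
  fix C assume "C \<in> touching D s c"
  then obtain A k where A: "C \<in> circles D s" "C = Inl A" "(c, k) \<in> A"
    unfolding touching_def touches_def by blast
  then obtain x where x: "x \<in> darts D" "A = circle_of D s x"
    unfolding circles_eq by blast
  with A(3) have "(c, k) \<in> darts D" "circle_of D s (c, k) = A"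
    using circle_of_subset_darts[of x s] circle_of_eqI[of "(c, k)" s x] by blast+
  then show "C \<in> {Inl (circle_of D s (c, 0)), Inl (circle_of D s (c, 2))}"
    using ends[of k] A(2) by (auto simp: in_darts_iff)
next
  fix C :: "'c circle"
  assume "C \<in> {Inl (circle_of D s (c, 0)), Inl (circle_of D s (c, 2))}"
  then obtain k where k: "k < 4" "C = Inl (circle_of D s (c, k))"
    using that[of 0] that[of 2] by auto
  then have "(c, k) \<in> darts D" using c by (simp add: in_darts_iff)
  then have "C \<in> circles D s" unfolding circles_eq k(2) by blast
  moreover have "touches C c" unfolding touches_def k(2) using circle_of_refl by blast
  ultimately show "C \<in> touching D s c" by (simp add: touching_def)
qed

text \<open>
  Deleting one smoothing arc from a circle leaves its two ends connected, by a handshake argument.  Let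
  \<open>A\<close> be the set of darts reachable from the end \<open>0\<close> when both arcs at \<open>c\<close> are deleted.  The gluing is a
  fixpoint-free involution on \<open>A\<close>, and the smoothing arcs of the other crossings give one on the darts of
  \<open>A\<close> away from \<open>c\<close>, so \<open>A\<close> has an even number of ends at \<open>c\<close>.  As the second circle is disjoint from \<open>A\<close>,
  the only possible partner of the end \<open>0\<close> is the other end of its own arc.  One of the two new arcs at
  \<open>c\<close> then leads from there to the end \<open>2\<close>.
\<close>

lemma touching_merge:
  assumes c: "c \<in> crossings D" and agree: "\<forall>c'\<in>crossings D - {c}. s c' = s' c'"
    and change: "s c = 1 \<longleftrightarrow> s' c \<noteq> 1"
    and two: "card (touching D s c) \<noteq> 1"
  shows "card (touching D s' c) = 1"
proof -
  define B where "B = smoothed D s - {x. fst (fst x) = c \<and> snd x \<noteq> glue D (fst x)}"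
  define A where "A = B\<^sup>* `` {(c, 0)}"
  let ?far = "opposite_end (s c) 0"
  have B_s: "B \<subseteq> smoothed D s"
    by (auto simp: B_def)
  have B_s': "B \<subseteq> smoothed D s'"
  proof
    fix e assume e: "e \<in> B"
    show "e \<in> smoothed D s'"
    proof (cases "fst (fst e) = c")
      case True
      with e show ?thesis by (cases e) (auto simp: B_def smoothed_iff)
    next
      case False
      with e B_s show ?thesis using smoothed_other_crossing[OF agree, of "fst e" "snd e"] by auto
    qed
  qed
  have A_s: "A \<subseteq> circle_of D s (c, 0)"
    using rtrancl_mono[OF B_s] by (auto simp: A_def circle_of_def)
  have A_darts: "A \<subseteq> darts D"
    using A_s circle_of_subset_darts c by (meson in_darts_iff order_trans zero_less_numeral)
  have A_step: "y \<in> A" if "x \<in> A" "(x, y) \<in> B" for x y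
    using that by (auto simp: A_def)
  have "even (card A)"
  proof (rule even_card_fixpoint_free_involution[where h = "glue D"])
    fix x assume x: "x \<in> A"
    then have dart: "x \<in> darts D" using A_darts by blast
    then show "glue D (glue D x) = x" "glue D x \<noteq> x" by (rule glue_dart)+
    show "glue D x \<in> A"
      using x dart A_step[of x "glue D x"] by (simp add: B_def smoothed_iff)
  qed
  moreover have "even (card (A - {x. fst x = c}))"
  proof (rule even_card_fixpoint_free_involution
      [where h = "\<lambda>x. (fst x, opposite_end (s (fst x)) (snd x))"])
    fix x assume x: "x \<in> A - {x. fst x = c}"
    let ?y = "(fst x, opposite_end (s (fst x)) (snd x))"
    have "x \<in> darts D" "fst x \<noteq> c" using x A_darts by blast+
    then have "(x, ?y) \<in> B" by (simp add: B_def smoothed_iff)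
    then show "?y \<in> A - {x. fst x = c}" using A_step[of x ?y] x by simp
    obtain a k where ak: "x = (a, k)" by (cases x) simp
    then have "k < 4" using \<open>x \<in> darts D\<close> by (simp add: in_darts_iff)
    then show "(fst ?y, opposite_end (s (fst ?y)) (snd ?y)) = x" "?y \<noteq> x"
      using opposite_end[of k "s a"] by (simp_all add: ak)
  qed
  moreover have "card A = card (A - {x. fst x = c}) + card (A \<inter> {x. fst x = c})"
    using card_Int_Diff[OF finite_subset[OF A_darts finite_darts], of "{x. fst x = c}"] by simp
  ultimately have even: "even (card (A \<inter> {x. fst x = c}))" by simp
  have distinct: "circle_of D s (c, 0) \<noteq> circle_of D s (c, 2)"
    using two touching_eq[OF c, of s] by auto
  have arc: "circle_of D s (c, opposite_end (s c) 2) = circle_of D s (c, 2)"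
    using circle_of_opposite_end[OF c] by simp
  \<comment> \<open>The other two ends at \<open>c\<close> lie on the second circle.\<close>
  have "A \<inter> {x. fst x = c} \<subseteq> {(c, 0), (c, ?far)}"
  proof
    fix x assume x: "x \<in> A \<inter> {x. fst x = c}"
    then obtain k where k: "x = (c, k)" by (cases x) simp
    have "x \<in> darts D" using x A_darts by blast
    then have k4: "k < 4" unfolding k by (simp add: in_darts_iff)
    have "x \<in> circle_of D s (c, 0)" using x A_s by blast
    then have "circle_of D s x = circle_of D s (c, 0)" by (rule circle_of_eqI)
    then have "k \<noteq> 2" "k \<noteq> opposite_end (s c) 2" using distinct arc unfolding k by metis+
    then have "k = 0 \<or> k = ?far"
      using k4 unfolding less_4_cases opposite_end_def by (cases "s c = 1") auto
    then show "x \<in> {(c, 0), (c, ?far)}" using k by auto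
  qed
  moreover have "(c, 0) \<in> A" by (simp add: A_def)
  ultimately have "A \<inter> {x. fst x = c} = {(c, 0)}" if "(c, ?far) \<notin> A"
    using that by auto
  then have "(c, ?far) \<in> A" using even by (cases "(c, ?far) \<in> A") simp_all
  then have far: "((c, 0), (c, ?far)) \<in> (smoothed D s')\<^sup>*"
    using rtrancl_mono[OF B_s'] by (auto simp: A_def)
  have "((c, ?far), (c, 2)) \<in> smoothed D s'"
    using c change opposite_end[of 0 "s c"]
    by (auto simp: smoothed_iff in_darts_iff opposite_end_def)
  with far have "((c, 0), (c, 2)) \<in> (smoothed D s')\<^sup>*" by simp
  then have "circle_of D s' (c, 0) = circle_of D s' (c, 2)" by (simp add: circle_of_eq_iff)
  then show ?thesis using touching_eq[OF c, of s'] by simp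
qed

lemma card_circles_split:
  "card (circles D s) = card {C \<in> circles D s. \<not> touches C c} + card (touching D s c)"
proof -
  have "circles D s = {C \<in> circles D s. \<not> touches C c} \<union> touching D s c"
    by (auto simp: touching_def)
  then show ?thesis
    using finite_circles[of s] card_Un_disjoint[of "{C \<in> circles D s. \<not> touches C c}" "touching D s c"]
    by (auto simp: touching_def)
qed

lemma nontouching_eq:
  assumes "\<forall>c'\<in>crossings D - {c}. s c' = s' c'"
  shows "{C \<in> circles D s. \<not> touches C c} = {C \<in> circles D s'. \<not> touches C c}"
  using circles_away_from_crossing[of c s s'] circles_away_from_crossing[of c s' s] assms by auto

lemma card_circles_le:
  assumes "c \<in> crossings D" "\<forall>c'\<in>crossings D - {c}. s c' = s' c'"
  shows "card (circles D s') \<le> card (circles D s) + 1"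
proof -
  have "card (touching D s' c) \<le> 2" "card (touching D s c) \<ge> 1"
    using touching_eq[OF assms(1)] by (auto simp: card_insert_if)
  then show ?thesis
    using card_circles_split[of s c] card_circles_split[of s' c] nontouching_eq[OF assms(2)] by simp
qed

lemma card_circles_merge:
  assumes "c \<in> crossings D" "\<forall>c'\<in>crossings D - {c}. s c' = s' c'" "s c = 1 \<longleftrightarrow> s' c \<noteq> 1"
    and "card (touching D s c) = 2"
  shows "card (circles D s) = card (circles D s') + 1"
  using touching_merge[OF assms(1,2,3)] assms(4) card_circles_split[of s c]
    card_circles_split[of s' c] nontouching_eq[OF assms(2)] by simp

end

section \<open>Odd cycles and torsion in quotients\<close>

text \<open>
  With \<open>g i = f (vs ! i)\<close> the sum is \<open>(g 0 + g 1) - (g 1 + g 2) + \<dots> + (g (L - 1) + g 0)\<close>, which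
  telescopes to \<open>2 * g 0\<close> because the number \<open>L\<close> of terms is odd.  For \<open>f\<close> with sum 1 over the ends of
  each edge, this contradicts parity; for \<open>f\<close> the indicator function of a vertex, it says that twice
  the vertex \<open>vs ! 0\<close> is a combination of edges.
\<close>

lemma odd_cycle_alternating_sum:
  fixes f :: "'v \<Rightarrow> int"
  assumes cyc: "is_cycle G vs es" and len: "odd (length es)"
    and no_loop: "\<And>e. e \<in> edges G \<Longrightarrow> card (ends G e) = 2"
  shows "(\<Sum>i<length es. (-1) ^ i * sum f (ends G (es ! i))) = 2 * f (vs ! 0)"
proof -
  define g where "g i = f (vs ! (i mod length vs))" for i
  have L: "length vs = length es" "length es > 0" using cyc by (auto simp: is_cycle_def)
  have edge: "sum f (ends G (es ! i)) = g i + g (i + 1)" if "i < length es" for i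
  proof -
    have e: "ends G (es ! i) = {vs ! i, vs ! ((i + 1) mod length vs)}"
      using cyc that unfolding is_cycle_def by blast
    moreover have "es ! i \<in> edges G" using cyc that nth_mem unfolding is_cycle_def by blast
    then have "vs ! i \<noteq> vs ! ((i + 1) mod length vs)" using no_loop[of "es ! i"] e by auto
    ultimately show ?thesis using that L by (simp add: g_def)
  qed
  have telescope: "(\<Sum>i<n. (-1) ^ i * (g i + g (i + 1))) = g 0 - (-1) ^ n * g n" for n
    by (induction n) (simp_all add: algebra_simps)
  have "(\<Sum>i<length es. (-1) ^ i * sum f (ends G (es ! i)))
      = (\<Sum>i<length es. (-1) ^ i * (g i + g (i + 1)))"
    by (rule sum.cong) (simp_all add: edge)
  also have "\<dots> = 2 * f (vs ! 0)"
    unfolding telescope using len L by (simp add: g_def)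
  finally show ?thesis .
qed

text \<open>
  The cosets of the elements of \<open>B\<close> form a subgroup of \<open>G Mod H\<close>, in which the coset of \<open>x\<close> has order
  two.
\<close>

lemma quotient_has_Z2_torsion:
  fixes G (structure)
  assumes "comm_group G" "subgroup B G" "subgroup H G"
    and x: "x \<in> B" "x \<notin> H" "x \<otimes> x \<in> H"
  shows "has_Z2_torsion (subgroup_generated G B Mod H)"
proof -
  interpret G: comm_group G by fact
  interpret B: subgroup B G by fact
  interpret N: normal H G using assms(3) by (simp add: G.normal_iff_subgroup)
  define Q where "Q = subgroup_generated G B Mod H"
  have coset: "r_coset (subgroup_generated G B) H b = H #> b" for b
    by (simp add: r_coset_def)
  have carrier_Q: "carrier Q = (\<lambda>b. H #> b) ` B"
    unfolding Q_def carrier_FactGroup by (simp add: coset)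
  have mult_Q: "K \<otimes>\<^bsub>Q\<^esub> K' = K <#> K'" for K K'
    by (simp add: Q_def set_mult_def)
  have one_Q: "\<one>\<^bsub>Q\<^esub> = H" by (simp add: Q_def)
  have Q_eq: "Q = (G Mod H)\<lparr>carrier := carrier Q\<rparr>"
    by (simp add: Q_def FactGroup_def set_mult_def fun_eq_iff)
  have "subgroup (carrier Q) (G Mod H)"
  proof (rule group.subgroupI[OF N.factorgroup_is_group])
    show "carrier Q \<subseteq> carrier (G Mod H)"
      using B.subset by (auto simp: carrier_Q carrier_FactGroup)
    show "carrier Q \<noteq> {}" using x(1) by (auto simp: carrier_Q)
    fix K assume "K \<in> carrier Q"
    then obtain b where b: "b \<in> B" "K = H #> b" by (auto simp: carrier_Q)
    then have "inv\<^bsub>G Mod H\<^esub> K = H #> inv b"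
      using B.subset by (subst N.inv_FactGroup) (auto simp: carrier_FactGroup N.rcos_inv)
    then show "inv\<^bsub>G Mod H\<^esub> K \<in> carrier Q" using b by (auto simp: carrier_Q)
    fix K' assume "K' \<in> carrier Q"
    then obtain b' where b': "b' \<in> B" "K' = H #> b'" by (auto simp: carrier_Q)
    then have "K \<otimes>\<^bsub>G Mod H\<^esub> K' = H #> (b \<otimes> b')"
      using b B.subset by (auto simp: N.rcos_sum)
    then show "K \<otimes>\<^bsub>G Mod H\<^esub> K' \<in> carrier Q" using b b' by (auto simp: carrier_Q)
  qed
  then have "group Q"
    using subgroup.subgroup_is_group[OF _ N.factorgroup_is_group] Q_eq by metis
  then interpret Q: group Q .
  define T where "T = H #> x"
  have xG: "x \<in> carrier G" using x(1) B.subset by blast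
  have TQ: "T \<in> carrier Q" using x(1) by (auto simp: T_def carrier_Q)
  have T_ne: "T \<noteq> H" using G.coset_join1[of H x] x(2) xG assms(3) by (auto simp: T_def)
  have TT: "T \<otimes>\<^bsub>Q\<^esub> T = H"
    using xG x(3) assms(3) by (simp add: mult_Q T_def N.rcos_sum G.coset_join2)
  have HQ: "H \<in> carrier Q" using Q.one_closed by (simp add: one_Q)
  have HK: "H \<otimes>\<^bsub>Q\<^esub> K = K" "K \<otimes>\<^bsub>Q\<^esub> H = K" if "K \<in> carrier Q" for K
    using that Q.l_one[of K] Q.r_one[of K] by (simp_all add: one_Q)
  have inv_T: "inv\<^bsub>Q\<^esub> T = T" using TT TQ by (intro Q.inv_equality) (auto simp: one_Q)
  have inv_H: "inv\<^bsub>Q\<^esub> H = H" using Q.inv_one by (simp add: one_Q)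
  let ?K = "{H, T}"
  have K: "subgroup ?K Q"
    by (rule Q.subgroupI) (auto simp: HQ TQ HK TT inv_T inv_H)
  have carrier_K: "carrier (subgroup_generated Q ?K) = ?K"
    using K by (rule subgroup.carrier_subgroup_generated_subgroup)
  have "(\<lambda>Y. if Y = H then 0 else 1) \<in> iso (subgroup_generated Q ?K) (integer_mod_group 2)"
    unfolding iso_def hom_def carrier_K
    by (auto simp: carrier_integer_mod_group bij_betw_def inj_on_def HQ TQ HK TT T_ne)
  then show ?thesis unfolding has_Z2_torsion_def Q_def[symmetric] is_iso_def using K by blast
qed

section \<open>Generators in the extreme quantum degrees\<close>

text \<open>
  Both halves of the theorem are treated together: \<open>m\<close> is the common marker of all crossings, so \<open>m = 1\<close>
  gives \<^const>\<open>state_plus\<close> and \<open>m = -1\<close> gives \<^const>\<open>state_minus\<close>.  A generator \<open>vertex_gen D m v\<close> is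
  attached to a vertex \<open>v\<close> of the state graph, namely to the only circle with the sign \<open>-m\<close>, and a
  generator \<open>edge_gen D m c\<close> to an edge \<open>c\<close>, the only crossing with the marker \<open>-m\<close>.
\<close>

definition const_state :: "'c diagram \<Rightarrow> int \<Rightarrow> 'c \<Rightarrow> int" where
  "const_state D m = (\<lambda>c\<in>crossings D. m)"

definition uniform :: "'c diagram \<Rightarrow> ('c \<Rightarrow> int) \<Rightarrow> int \<Rightarrow> 'c enhanced_state" where
  "uniform D s m = (s, \<lambda>C\<in>circles D s. m)"

definition edge_gen :: "'c diagram \<Rightarrow> int \<Rightarrow> 'c \<Rightarrow> 'c enhanced_state" where
  "edge_gen D m c = uniform D ((const_state D m)(c := -m)) m"

definition vertex_gen :: "'c diagram \<Rightarrow> int \<Rightarrow> 'c circle \<Rightarrow> 'c enhanced_state" where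
  "vertex_gen D m v = (const_state D m, (\<lambda>C\<in>circles D (const_state D m). m)(v := -m))"

lemma card_diff_signs:
  fixes f :: "'a \<Rightarrow> int"
  assumes "finite A" "\<And>x. x \<in> A \<Longrightarrow> f x \<in> {1, -1}" "m \<in> {1, -1}"
  shows "int (card {x \<in> A. f x = 1}) - int (card {x \<in> A. f x = -1})
    = m * (int (card A) - 2 * int (card {x \<in> A. f x = -m}))"
proof -
  have "A \<inter> {x. f x = 1} = {x \<in> A. f x = 1}" "A - {x. f x = 1} = {x \<in> A. f x = -1}"
    using assms(2) by auto
  then have "card A = card {x \<in> A. f x = 1} + card {x \<in> A. f x = -1}"
    using card_Int_Diff[OF assms(1), of "{x. f x = 1}"] by simp
  then show ?thesis using assms(3) by auto
qed

lemma PiE_eq_restrict: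
  assumes "f \<in> A \<rightarrow>\<^sub>E B" "\<And>x. x \<in> A \<Longrightarrow> f x = g x"
  shows "f = restrict g A"
  using assms by (auto simp: fun_eq_iff PiE_def extensional_def)

lemma incidence_commute: "incidence D S S' = incidence D S' S"
proof -
  have "{c \<in> crossings D. fst S c \<noteq> fst S' c} = {c \<in> crossings D. fst S' c \<noteq> fst S c}"
    by auto
  then have "differ_only_at D S S' c \<longleftrightarrow> differ_only_at D S' S c" for c
    by (simp add: differ_only_at_def)
  moreover have "(\<forall>C \<in> circles D (fst S) \<union> circles D (fst S'). \<not> touches C c \<longrightarrow> snd S C = snd S' C) \<longleftrightarrow>
      (\<forall>C \<in> circles D (fst S') \<union> circles D (fst S). \<not> touches C c \<longrightarrow> snd S' C = snd S C)" for c
    unfolding Un_commute[of "circles D (fst S')"] eq_commute[of "snd S' _"] by (rule refl)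
  ultimately show ?thesis by (simp only: incidence_def)
qed

lemma differ_only_at_fun_upd:
  assumes "c \<in> crossings D" "s c \<noteq> x"
  shows "differ_only_at D (s, e) (s(c := x), e') a \<longleftrightarrow> a = c"
proof -
  have "{c' \<in> crossings D. s c' \<noteq> (s(c := x)) c'} = {c}" using assms by auto
  then show ?thesis by (auto simp: differ_only_at_def)
qed

lemma incidence_fun_upd:
  assumes "c \<in> crossings D" "s c \<noteq> x"
  shows "incidence D (s, e) (s(c := x), e') =
    (if \<forall>C \<in> circles D s \<union> circles D (s(c := x)). \<not> touches C c \<longrightarrow> e C = e' C then 1 else 0)"
  by (simp add: incidence_def differ_only_at_fun_upd[of c D s x, OF assms])

lemma sign_exponent_fun_upd:
  assumes "c \<in> crossings D" "s c \<noteq> x"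
  shows "sign_exponent D (s, e) (s(c := x), e') = card {c' \<in> crossings D. s c' = -1 \<and> c < c'}"
  by (simp add: sign_exponent_def differ_only_at_fun_upd[of c D s x, OF assms])

lemma sign_exponent_fun_upd':
  assumes "c \<in> crossings D" "s c \<noteq> x"
  shows "sign_exponent D (s(c := x), e) (s, e')
    = card {c' \<in> crossings D. (s(c := x)) c' = -1 \<and> c < c'}"
  using sign_exponent_fun_upd[of c D "s(c := x)" "s c" e e'] assms by simp

text \<open>
  The state graph has no loops: two circles touch at each crossing.
\<close>

locale adequate_diagram =
  fixes D :: "('c :: linorder) diagram" and m :: int
  assumes D: "link_diagram D" and m: "m \<in> {1, -1}"
    and adequate: "\<And>c. c \<in> crossings D \<Longrightarrow> card (touching D (const_state D m) c) = 2"
begin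

abbreviation "s\<^sub>0 \<equiv> const_state D m"
abbreviation "N \<equiv> int (card (crossings D))"
abbreviation "n \<equiv> int (card (circles D s\<^sub>0))"
abbreviation "J \<equiv> m * (N + 2 * n - 4)"

text \<open>
  Both degrees count entries of sign \<open>-m\<close>.  If \<open>k\<close> crossings have the marker \<open>-m\<close>, then the quantum
  degree \<open>J\<close> fixes the number of circles of sign \<open>-m\<close> in terms of the number of circles.  As changing
  \<open>k\<close> markers of an adequate state leaves few circles, this determines the generators for \<open>k \<le> 2\<close>.
\<close>

lemma generators_iff:
  "S \<in> generators D (m * (N - 2 * int k)) J \<longleftrightarrow>
     S \<in> enhanced_states D \<and> card {c \<in> crossings D. fst S c = -m} = k \<and>
     int (card (circles D (fst S))) = n - 2 + int k + 2 * int (card {C \<in> circles D (fst S). snd S C = -m})"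
proof (cases "S \<in> enhanced_states D")
  case True
  then have signs: "\<And>c. c \<in> crossings D \<Longrightarrow> fst S c \<in> {1, -1}"
    "\<And>C. C \<in> circles D (fst S) \<Longrightarrow> snd S C \<in> {1, -1}"
    by (auto simp: enhanced_states_def kauffman_states_def PiE_def Pi_def)
  have "sigma D (fst S) = m * (N - 2 * int (card {c \<in> crossings D. fst S c = -m}))"
    unfolding sigma_def using finite_crossings[OF D] signs(1) m by (rule card_diff_signs)
  moreover have "tau D S = m * (int (card (circles D (fst S)))
      - 2 * int (card {C \<in> circles D (fst S). snd S C = -m}))"
    unfolding tau_def using finite_circles[OF D] signs(2) m by (rule card_diff_signs)
  moreover have "m * (a - 2 * K) = m * (a - 2 * l) \<and>
        m * (a - 2 * K) + 2 * (m * (b - 2 * q)) = m * (a + 2 * d - 4) \<longleftrightarrow>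
      K = l \<and> b = d - 2 + l + 2 * q" for a b d K l q :: int
  proof -
    from m consider "m = 1" | "m = -1" by blast
    then show ?thesis by cases (simp_all, linarith+)
  qed
  ultimately show ?thesis using True by (simp only: generators_def mem_Collect_eq of_nat_eq_iff simp_thms)
qed (simp add: generators_def)

lemma const_state_in: "s\<^sub>0 \<in> kauffman_states D"
  using m by (auto simp: const_state_def kauffman_states_def)

lemma flip_in_kauffman_states:
  "c \<in> crossings D \<Longrightarrow> s \<in> kauffman_states D \<Longrightarrow> s(c := -m) \<in> kauffman_states D"
  using m PiE_fun_upd[of "-m" "\<lambda>_. {1, -1}" c s "crossings D"]
  by (auto simp: kauffman_states_def insert_absorb)

lemma const_state_at: "c \<in> crossings D \<Longrightarrow> s\<^sub>0 c = m"
  by (simp add: const_state_def)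

lemma m_ne: "m \<noteq> -m" "-m \<noteq> m"
  using m by auto

lemma uniform_in_enhanced: "s \<in> kauffman_states D \<Longrightarrow> uniform D s m \<in> enhanced_states D"
  using m by (auto simp: uniform_def enhanced_states_def)

lemma uniform_count: "{C \<in> circles D s. snd (uniform D s m) C = -m} = {}"
  using m_ne by (auto simp: uniform_def)

lemma state_from_flipped:
  assumes "s \<in> kauffman_states D" "\<And>c. c \<in> crossings D \<Longrightarrow> s c = -m \<longleftrightarrow> c \<in> F"
  shows "s = (\<lambda>c\<in>crossings D. if c \<in> F then -m else m)"
proof (rule PiE_eq_restrict)
  show "s \<in> crossings D \<rightarrow>\<^sub>E {1, -1}" using assms(1) by (simp add: kauffman_states_def)
  fix c assume c: "c \<in> crossings D"
  then have "s c \<in> {1, -1}" using assms(1) by (auto simp: kauffman_states_def)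
  then show "s c = (if c \<in> F then -m else m)" using assms(2)[OF c] m by auto
qed

lemma uniform_from_count:
  assumes "S \<in> enhanced_states D" "card {C \<in> circles D (fst S). snd S C = -m} = 0"
  shows "S = uniform D (fst S) m"
proof -
  have e: "snd S \<in> circles D (fst S) \<rightarrow>\<^sub>E {1, -1}"
    using assms(1) by (auto simp: enhanced_states_def)
  have "snd S C = m" if "C \<in> circles D (fst S)" for C
  proof -
    have "snd S C \<in> {1, -1}" using e that by auto
    moreover have "snd S C \<noteq> -m" using assms(2) that finite_circles[OF D] by auto
    ultimately show ?thesis using m by auto
  qed
  then have "snd S = (\<lambda>C\<in>circles D (fst S). m)" using e by (intro PiE_eq_restrict) auto
  then show ?thesis by (simp add: uniform_def prod_eq_iff)
qed

text \<open>
  By adequacy, the first change of a marker merges two circles.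
\<close>

lemma card_circles_one_flip:
  assumes "c \<in> crossings D"
  shows "int (card (circles D (s\<^sub>0(c := -m)))) = n - 1"
proof -
  have "card (circles D s\<^sub>0) = card (circles D (s\<^sub>0(c := -m))) + 1"
  proof (rule card_circles_merge[OF D assms])
    show "s\<^sub>0 c = 1 \<longleftrightarrow> (s\<^sub>0(c := -m)) c \<noteq> 1"
      using m const_state_at[OF assms] by auto
  qed (simp_all add: adequate assms)
  then show ?thesis by simp
qed

lemma vertex_generators: "generators D (m * N) J = vertex_gen D m ` circles D s\<^sub>0"
proof (intro subset_antisym subsetI)
  fix S assume "S \<in> generators D (m * N) J"
  then have S: "S \<in> enhanced_states D" "card {c \<in> crossings D. fst S c = -m} = 0"
    "int (card (circles D (fst S))) = n - 2 + 2 * int (card {C \<in> circles D (fst S). snd S C = -m})"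
    using generators_iff[of S 0] by simp_all
  have "fst S \<in> kauffman_states D" using S(1) by (auto simp: enhanced_states_def)
  then have "fst S = (\<lambda>c\<in>crossings D. if c \<in> {} then -m else m)"
    by (rule state_from_flipped) (use S(2) finite_crossings[OF D] in auto)
  then have s: "fst S = s\<^sub>0" by (simp add: const_state_def)
  with S(3) have "card {C \<in> circles D s\<^sub>0. snd S C = -m} = 1" by simp
  then obtain v where v: "{C \<in> circles D s\<^sub>0. snd S C = -m} = {v}" by (rule card_1_singletonE)
  have e: "snd S \<in> circles D s\<^sub>0 \<rightarrow>\<^sub>E {1, -1}" using S(1) s by (auto simp: enhanced_states_def)
  have "snd S = (\<lambda>C\<in>circles D s\<^sub>0. if C = v then -m else m)"
  proof (rule PiE_eq_restrict[OF e])
    fix C assume C: "C \<in> circles D s\<^sub>0"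
    then have "snd S C \<in> {1, -1}" using e by auto
    moreover have "snd S C = -m \<longleftrightarrow> C = v" using v C by blast
    ultimately show "snd S C = (if C = v then -m else m)" using m by auto
  qed
  moreover have "v \<in> circles D s\<^sub>0" using v by blast
  ultimately have "S = vertex_gen D m v"
    using s by (auto simp: vertex_gen_def prod_eq_iff fun_eq_iff)
  then show "S \<in> vertex_gen D m ` circles D s\<^sub>0" using \<open>v \<in> circles D s\<^sub>0\<close> by blast
next
  fix S assume "S \<in> vertex_gen D m ` circles D s\<^sub>0"
  then obtain v where v: "v \<in> circles D s\<^sub>0" "S = vertex_gen D m v" by blast
  have "S \<in> enhanced_states D"
    using v m const_state_in by (auto simp: vertex_gen_def enhanced_states_def PiE_def extensional_def split: if_splits)
  moreover have fst_S: "fst S = s\<^sub>0" by (simp add: v(2) vertex_gen_def)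
  moreover have "{c \<in> crossings D. s\<^sub>0 c = -m} = {}"
    using m_ne by (auto simp: const_state_at)
  then have "card {c \<in> crossings D. s\<^sub>0 c = -m} = 0" by (simp only: card.empty)
  moreover have "{C \<in> circles D s\<^sub>0. snd S C = -m} = {v}"
    using m_ne v by (auto simp: vertex_gen_def)
  then have "n = n - 2 + int 0 + 2 * int (card {C \<in> circles D s\<^sub>0. snd S C = -m})" by simp
  ultimately have "S \<in> generators D (m * (N - 2 * int 0)) J"
    unfolding generators_iff by metis
  then show "S \<in> generators D (m * N) J" by simp
qed

lemma edge_generators: "generators D (m * (N - 2)) J = edge_gen D m ` crossings D"
proof (intro subset_antisym subsetI)
  fix S assume "S \<in> generators D (m * (N - 2)) J"
  then have S: "S \<in> enhanced_states D" "card {c \<in> crossings D. fst S c = -m} = 1"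
    "int (card (circles D (fst S))) = n - 1 + 2 * int (card {C \<in> circles D (fst S). snd S C = -m})"
    using generators_iff[of S 1] by simp_all
  from S(2) obtain c where c: "{c \<in> crossings D. fst S c = -m} = {c}" by (rule card_1_singletonE)
  then have c': "c \<in> crossings D" by blast
  have "fst S \<in> kauffman_states D" using S(1) by (auto simp: enhanced_states_def)
  then have "fst S = (\<lambda>c'\<in>crossings D. if c' \<in> {c} then -m else m)"
    by (rule state_from_flipped) (use c in blast)
  then have s: "fst S = s\<^sub>0(c := -m)" using c' by (auto simp: const_state_def fun_eq_iff)
  then have "card {C \<in> circles D (fst S). snd S C = -m} = 0"
    using S(3) card_circles_one_flip[OF c'] by simp
  from uniform_from_count[OF S(1) this] have "S = edge_gen D m c" by (simp add: edge_gen_def s)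
  then show "S \<in> edge_gen D m ` crossings D" using c' by blast
next
  fix S assume "S \<in> edge_gen D m ` crossings D"
  then obtain c where c: "c \<in> crossings D" "S = uniform D (s\<^sub>0(c := -m)) m"
    by (auto simp: edge_gen_def)
  have "{c' \<in> crossings D. (s\<^sub>0(c := -m)) c' = -m} = {c}"
    using c m_ne by (auto simp: const_state_at)
  then have "card {c' \<in> crossings D. (s\<^sub>0(c := -m)) c' = -m} = 1" by simp
  moreover have "fst S = s\<^sub>0(c := -m)" by (simp add: c uniform_def)
  moreover have "S \<in> enhanced_states D"
    unfolding c(2) using c(1) by (intro uniform_in_enhanced flip_in_kauffman_states const_state_in)
  moreover have "int (card (circles D (s\<^sub>0(c := -m)))) =
      n - 2 + int 1 + 2 * int (card {C \<in> circles D (s\<^sub>0(c := -m)). snd S C = -m})"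
    unfolding c(2) uniform_count card_circles_one_flip[OF c(1)] by simp
  ultimately have "S \<in> generators D (m * (N - 2 * int 1)) J"
    unfolding generators_iff by metis
  then show "S \<in> generators D (m * (N - 2)) J" by simp
qed

text \<open>
  The first change of a marker loses one circle and the second one gains at most one, so the degree
  leaves no room for a circle of sign \<open>-m\<close>.
\<close>

lemma two_flip_generators:
  assumes "S \<in> generators D (m * (N - 4)) J"
  obtains a b where "a \<in> crossings D" "b \<in> crossings D" "a \<noteq> b"
    "S = uniform D (s\<^sub>0(a := -m, b := -m)) m"
proof -
  from assms have S: "S \<in> enhanced_states D" "card {c \<in> crossings D. fst S c = -m} = 2"
    "int (card (circles D (fst S))) = n + 2 * int (card {C \<in> circles D (fst S). snd S C = -m})"
    using generators_iff[of S 2] by simp_all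
  from S(2) obtain a b where ab: "{c \<in> crossings D. fst S c = -m} = {a, b}" "a \<noteq> b"
    by (auto simp: card_2_iff)
  then have ab': "a \<in> crossings D" "b \<in> crossings D" by blast+
  have "fst S \<in> kauffman_states D" using S(1) by (auto simp: enhanced_states_def)
  then have "fst S = (\<lambda>c'\<in>crossings D. if c' \<in> {a, b} then -m else m)"
    by (rule state_from_flipped) (use ab in blast)
  then have s: "fst S = s\<^sub>0(a := -m, b := -m)" using ab' by (auto simp: const_state_def fun_eq_iff)
  have "card (circles D (s\<^sub>0(a := -m, b := -m))) \<le> card (circles D (s\<^sub>0(a := -m))) + 1"
    using ab' by (intro card_circles_le[OF D, of b]) auto
  then have "card {C \<in> circles D (fst S). snd S C = -m} = 0"
    using S(3) card_circles_one_flip[OF ab'(1)] by (simp add: s)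
  from uniform_from_count[OF S(1) this] show ?thesis using that[OF ab' ab(2)] by (simp add: s)
qed

lemma inj_edge_gen: "inj_on (edge_gen D m) (crossings D)"
proof (rule inj_onI)
  fix a b assume ab: "a \<in> crossings D" "b \<in> crossings D" "edge_gen D m a = edge_gen D m b"
  then have "(s\<^sub>0(a := -m)) a = (s\<^sub>0(b := -m)) a" by (simp add: edge_gen_def uniform_def)
  then show "a = b" using ab m_ne by (auto simp: const_state_at split: if_splits)
qed

lemma inj_vertex_gen: "inj_on (vertex_gen D m) (circles D s\<^sub>0)"
proof (rule inj_onI)
  fix v w assume vw: "v \<in> circles D s\<^sub>0" "w \<in> circles D s\<^sub>0" "vertex_gen D m v = vertex_gen D m w"
  then have "snd (vertex_gen D m v) v = snd (vertex_gen D m w) v" by simp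
  then show "v = w" using vw m_ne by (auto simp: vertex_gen_def split: if_splits)
qed

section \<open>Incidence numbers\<close>

text \<open>
  Since all circles of \<open>edge_gen D m c\<close> have the sign \<open>m\<close>, the exceptional circle \<open>v\<close> has to be one of
  those that may change their sign, the circles touching \<open>c\<close>.
\<close>

lemma incidence_vertex_edge:
  assumes c: "c \<in> crossings D" and v: "v \<in> circles D s\<^sub>0"
  shows "incidence D (vertex_gen D m v) (edge_gen D m c) = of_bool (v \<in> touching D s\<^sub>0 c)"
proof -
  let ?s = "s\<^sub>0(c := -m)"
  have common: "{C \<in> circles D s\<^sub>0. \<not> touches C c} = {C \<in> circles D ?s. \<not> touches C c}"
    by (rule nontouching_eq[OF D]) simp
  then have "C \<in> circles D s\<^sub>0 \<longleftrightarrow> C \<in> circles D ?s" if "\<not> touches C c" for C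
    using that by blast
  then have "(\<forall>C \<in> circles D s\<^sub>0 \<union> circles D ?s. \<not> touches C c \<longrightarrow>
      ((\<lambda>C\<in>circles D s\<^sub>0. m)(v := -m)) C = (\<lambda>C\<in>circles D ?s. m) C) \<longleftrightarrow> touches v c"
    using v m_ne by auto
  moreover have "s\<^sub>0 c \<noteq> -m" using c m_ne by (simp add: const_state_at)
  ultimately show ?thesis
    unfolding vertex_gen_def edge_gen_def uniform_def incidence_fun_upd[of c D "s\<^sub>0" "-m", OF c \<open>s\<^sub>0 c \<noteq> -m\<close>]
    using v by (simp add: touching_def)
qed

lemma incidence_uniform:
  assumes c: "c \<in> crossings D" "s c = m"
  shows "incidence D (uniform D s m) (uniform D (s(c := -m)) m) = 1"
proof -
  have "{C \<in> circles D s. \<not> touches C c} = {C \<in> circles D (s(c := -m)). \<not> touches C c}"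
    by (rule nontouching_eq[OF D]) simp
  then have "C \<in> circles D s \<longleftrightarrow> C \<in> circles D (s(c := -m))" if "\<not> touches C c" for C
    using that by blast
  then have "\<forall>C \<in> circles D s \<union> circles D (s(c := -m)). \<not> touches C c \<longrightarrow>
      (\<lambda>C\<in>circles D s. m) C = (\<lambda>C\<in>circles D (s(c := -m)). m) C"
    by auto
  moreover have "s c \<noteq> -m" using c m_ne by simp
  ultimately show ?thesis unfolding uniform_def incidence_fun_upd[of c D s "-m", OF c(1) \<open>s c \<noteq> -m\<close>] by simp
qed

lemma incidence_edge_other:
  assumes "a \<in> crossings D" "b \<in> crossings D" "a \<noteq> b" "c \<notin> {a, b}"
  shows "incidence D (edge_gen D m c) (uniform D (s\<^sub>0(a := -m, b := -m)) m) = 0"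
proof -
  have "\<not> differ_only_at D (edge_gen D m c) (uniform D (s\<^sub>0(a := -m, b := -m)) m) x" for x
  proof
    assume "differ_only_at D (edge_gen D m c) (uniform D (s\<^sub>0(a := -m, b := -m)) m) x"
    then have "{c' \<in> crossings D. (s\<^sub>0(c := -m)) c' \<noteq> (s\<^sub>0(a := -m, b := -m)) c'} = {x}"
      by (simp add: differ_only_at_def edge_gen_def uniform_def)
    moreover have "{a, b} \<subseteq> {c' \<in> crossings D. (s\<^sub>0(c := -m)) c' \<noteq> (s\<^sub>0(a := -m, b := -m)) c'}"
      using assms m_ne by (auto simp: const_state_at)
    ultimately show False using assms(3) by auto
  qed
  then show ?thesis by (simp add: incidence_def)
qed

end

section \<open>The chain complex in coordinates\<close>

definition boundary_coeff ::
    "('c :: linorder) diagram \<Rightarrow> 'c enhanced_state \<Rightarrow> 'c enhanced_state \<Rightarrow> int" where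
  "boundary_coeff D S S' = (-1) ^ sign_exponent D S S' * incidence D S S'"

lemma finite_generators:
  assumes "link_diagram D"
  shows "finite (generators D i j)"
proof (rule finite_subset)
  show "generators D i j \<subseteq> enhanced_states D" by (auto simp: generators_def)
  show "finite (enhanced_states D)"
    unfolding enhanced_states_def kauffman_states_def
    using finite_crossings[OF assms] finite_circles[OF assms] by (intro finite_SigmaI finite_PiE) auto
qed

lemma lookup_sum_frag_of:
  assumes "finite A"
  shows "Poly_Mapping.lookup (\<Sum>S\<in>A. frag_of S) T = of_bool (T \<in> A)"
  using assms by (simp add: lookup_sum sum.delta)

lemma lookup_differential:
  assumes "link_diagram D" "Poly_Mapping.keys u \<subseteq> generators D i j"
  shows "Poly_Mapping.lookup (differential D i j u) S' =
    (if S' \<in> generators D (i - 2) j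
     then \<Sum>S\<in>generators D i j. Poly_Mapping.lookup u S * boundary_coeff D S S' else 0)"
proof -
  have inner: "Poly_Mapping.lookup (\<Sum>T\<in>generators D (i - 2) j.
      frag_cmul ((-1) ^ sign_exponent D S T * incidence D S T) (frag_of T)) S' =
      (if S' \<in> generators D (i - 2) j then boundary_coeff D S S' else 0)" for S
  proof -
    have "Poly_Mapping.lookup (\<Sum>T\<in>generators D (i - 2) j.
        frag_cmul ((-1) ^ sign_exponent D S T * incidence D S T) (frag_of T)) S' =
      (\<Sum>T\<in>generators D (i - 2) j. if S' = T then boundary_coeff D S T else 0)"
      unfolding lookup_sum by (rule sum.cong) (simp_all add: boundary_coeff_def)
    then show ?thesis using finite_generators[OF assms(1)] by (simp add: sum.delta)
  qed
  have "Poly_Mapping.lookup (differential D i j u) S' =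
      (\<Sum>S\<in>Poly_Mapping.keys u. Poly_Mapping.lookup u S *
        (if S' \<in> generators D (i - 2) j then boundary_coeff D S S' else 0))"
    by (simp only: differential_def frag_extend_def lookup_sum[of _ "Poly_Mapping.keys u"]
        lookup_frag_cmul[of _ "sum _ _"] inner)
  also have "\<dots> = (\<Sum>S\<in>generators D i j. Poly_Mapping.lookup u S *
        (if S' \<in> generators D (i - 2) j then boundary_coeff D S S' else 0))"
    using assms(2) finite_generators[OF assms(1)]
    by (intro sum.mono_neutral_left) (auto simp: in_keys_iff)
  finally show ?thesis by simp
qed

lemma differential_closed:
  assumes "link_diagram D" "Poly_Mapping.keys u \<subseteq> generators D i j"
  shows "Poly_Mapping.keys (differential D i j u) \<subseteq> generators D (i - 2) j"
  using lookup_differential[OF assms] by (auto simp: in_keys_iff split: if_splits)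

lemma group_hom_differential:
  assumes "link_diagram D"
  shows "group_hom (chain_group D i j) (chain_group D (i - 2) j) (differential D i j)"
  unfolding group_hom_def group_hom_axioms_def hom_def chain_group_def
  using differential_closed[OF assms] by (auto simp: differential_def frag_extend_add)

text \<open>
  The class of the cycle \<open>x\<close> has order two, as \<open>x\<close> is not a boundary but \<open>2 x\<close> is the boundary of \<open>y\<close>.
\<close>

lemma khovanov_homology_has_Z2_torsion:
  assumes D: "link_diagram D"
    and x: "Poly_Mapping.keys x \<subseteq> generators D i j"
    and cycle: "differential D i j x = 0"
    and nonboundary: "\<And>u. Poly_Mapping.keys u \<subseteq> generators D (i + 2) j \<Longrightarrow> differential D (i + 2) j u \<noteq> x"
    and y: "Poly_Mapping.keys y \<subseteq> generators D (i + 2) j" "differential D (i + 2) j y = x + x"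
  shows "has_Z2_torsion (khovanov_homology D i j)"
  unfolding khovanov_homology_def
proof (rule quotient_has_Z2_torsion)
  show "comm_group (chain_group D i j)"
    by (simp add: chain_group_def abelian_free_Abelian_group)
  show "subgroup (kernel (chain_group D i j) (chain_group D (i - 2) j) (differential D i j))
      (chain_group D i j)"
    by (rule group_hom.subgroup_kernel[OF group_hom_differential[OF D]])
  show "subgroup (differential D (i + 2) j ` carrier (chain_group D (i + 2) j)) (chain_group D i j)"
    using group_hom.img_is_subgroup[OF group_hom_differential[OF D, of "i + 2" j]] by simp
  show "x \<in> kernel (chain_group D i j) (chain_group D (i - 2) j) (differential D i j)"
    using x cycle by (simp add: kernel_def chain_group_def)
  show "x \<notin> differential D (i + 2) j ` carrier (chain_group D (i + 2) j)"
  proof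
    assume "x \<in> differential D (i + 2) j ` carrier (chain_group D (i + 2) j)"
    then obtain u where "Poly_Mapping.keys u \<subseteq> generators D (i + 2) j" "differential D (i + 2) j u = x"
      unfolding chain_group_def by auto
    then show False using nonboundary by blast
  qed
  show "x \<otimes>\<^bsub>chain_group D i j\<^esub> x \<in> differential D (i + 2) j ` carrier (chain_group D (i + 2) j)"
    unfolding chain_group_def mult_free_Abelian_group y(2)[symmetric] using y(1) by (intro imageI) simp
qed

lemma ends_state_graph: "ends (state_graph D s) c = touching D s c"
  by (simp add: state_graph_def touching_def)

lemma edges_state_graph: "edges (state_graph D s) = crossings D"
  by (simp add: state_graph_def)

text \<open>
  At most two circles touch at a crossing, and if it were only one, the crossing would be a loop.
\<close>

lemma card_touching_eq_2:
  assumes "link_diagram D" "has_no_loops (state_graph D s)" "c \<in> crossings D"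
  shows "card (touching D s c) = 2"
proof -
  obtain v w where vw: "touching D s c = {v, w}" using touching_eq[OF assms(1,3)] by blast
  have "v \<in> circles D s" using vw by (auto simp: touching_def)
  then have "touching D s c \<noteq> {v}"
    using assms(2,3) by (auto simp: has_no_loops_def ends_state_graph edges_state_graph state_graph_def touching_def)
  then show ?thesis using vw by (cases "v = w") auto
qed

section \<open>The differential between the extreme generators\<close>

context adequate_diagram
begin

lemma boundary_vertex_edge:
  assumes m1: "m = 1" and c: "c \<in> crossings D" and v: "v \<in> circles D s\<^sub>0"
  shows "boundary_coeff D (vertex_gen D m v) (edge_gen D m c) = of_bool (v \<in> touching D s\<^sub>0 c)"
proof -
  have "{c' \<in> crossings D. s\<^sub>0 c' = -1 \<and> c < c'} = {}" using m1 by (auto simp: const_state_def)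
  moreover have "s\<^sub>0 c \<noteq> -m" using c m_ne by (simp only: const_state_at not_False_eq_True)
  ultimately have "sign_exponent D (vertex_gen D m v) (edge_gen D m c) = 0"
    unfolding vertex_gen_def edge_gen_def uniform_def
    by (simp only: sign_exponent_fun_upd[of c D "s\<^sub>0" "-m", OF c] card.empty not_False_eq_True)
  then show ?thesis by (simp add: boundary_coeff_def incidence_vertex_edge[OF c v])
qed

text \<open>
  The sign with which \<open>edge_gen D m c\<close> is mapped to the generators of its two end vertices.  It depends
  only on \<open>c\<close>, and hence can be absorbed into the coefficient of \<open>edge_gen D m c\<close>.
\<close>

definition edge_sign :: "'c \<Rightarrow> int" where
  "edge_sign c = (-1) ^ card {c' \<in> crossings D. (s\<^sub>0(c := -m)) c' = -1 \<and> c < c'}"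

lemma edge_sign_sq: "edge_sign c * edge_sign c = 1"
  by (simp add: edge_sign_def flip: power_add mult_2)

lemma boundary_edge_vertex:
  assumes c: "c \<in> crossings D" and v: "v \<in> circles D s\<^sub>0"
  shows "boundary_coeff D (edge_gen D m c) (vertex_gen D m v)
    = edge_sign c * of_bool (v \<in> touching D s\<^sub>0 c)"
proof -
  have "s\<^sub>0 c \<noteq> -m" using c m_ne by (simp only: const_state_at not_False_eq_True)
  then have "(-1) ^ sign_exponent D (edge_gen D m c) (vertex_gen D m v) = edge_sign c"
    unfolding vertex_gen_def edge_gen_def uniform_def edge_sign_def
    by (simp only: sign_exponent_fun_upd'[of c D "s\<^sub>0" "-m", OF c] not_False_eq_True)
  then show ?thesis
    by (simp add: boundary_coeff_def incidence_commute[of D "edge_gen D m c"] incidence_vertex_edge[OF c v])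
qed

text \<open>
  The crossing \<open>a\<close> is the only one of \<open>edge_gen D 1 a\<close> with a negative marker, so it contributes to the sign
  exactly if it is bigger than the changed crossing \<open>b\<close>.  Thus the two ways of changing \<open>a\<close> and \<open>b\<close>
  one after the other have opposite signs.
\<close>

lemma boundary_edge_two_flip:
  assumes m1: "m = 1" and ab: "a \<in> crossings D" "b \<in> crossings D" "a \<noteq> b"
  shows "boundary_coeff D (edge_gen D m a) (uniform D (s\<^sub>0(a := -m, b := -m)) m)
    = (if b < a then -1 else 1)"
proof -
  have b: "(s\<^sub>0(a := -m)) b = m" using ab by (simp add: const_state_at)
  have "{c \<in> crossings D. (s\<^sub>0(a := -m)) c = -1 \<and> b < c} = (if b < a then {a} else {})"
    using ab m1 by (auto simp: const_state_def)
  moreover have "(s\<^sub>0(a := -m)) b \<noteq> -m" using b m_ne by simp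
  ultimately have "sign_exponent D (edge_gen D m a) (uniform D (s\<^sub>0(a := -m, b := -m)) m)
      = card (if b < a then {a} else {})"
    unfolding edge_gen_def uniform_def
    by (simp only: sign_exponent_fun_upd[of b D "s\<^sub>0(a := -m)" "-m", OF ab(2)] not_False_eq_True)
  then show ?thesis
    using incidence_uniform[of b "s\<^sub>0(a := -m)", OF ab(2) b]
    by (simp add: boundary_coeff_def edge_gen_def)
qed

lemma touching_subset: "touching D s\<^sub>0 c \<subseteq> circles D s\<^sub>0"
  by (auto simp: touching_def)

lemma sum_touching:
  fixes f :: "'c circle \<Rightarrow> int"
  shows "(\<Sum>v\<in>circles D s\<^sub>0. f v * of_bool (v \<in> touching D s\<^sub>0 c)) = sum f (touching D s\<^sub>0 c)"
proof -
  have "(\<Sum>v\<in>circles D s\<^sub>0. f v * of_bool (v \<in> touching D s\<^sub>0 c))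
      = (\<Sum>v\<in>circles D s\<^sub>0. if v \<in> touching D s\<^sub>0 c then f v else 0)"
    by (rule sum.cong) auto
  also have "\<dots> = sum f (circles D s\<^sub>0 \<inter> touching D s\<^sub>0 c)"
    using finite_circles[OF D] by (simp add: sum.inter_restrict)
  finally show ?thesis using touching_subset[of c] by (simp add: Int_absorb1)
qed

section \<open>Torsion from an odd cycle\<close>

text \<open>
  For \<open>m = 1\<close> the differential from the vertices to the edges sends a vertex to the sum of its incident
  edges, without signs.  Let \<open>x\<close> be the sum of all edges and \<open>y\<close> the sum of all vertices.  Each edge has two
  ends, so \<open>2 x\<close> is the boundary of \<open>y\<close>.  The coefficient of \<open>d x\<close> at a state with two changed markers is
  the sum of the two opposite signs of \<open>boundary_edge_two_flip\<close>, so \<open>x\<close> is a cycle.  If \<open>x\<close> were the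
  boundary of \<open>u\<close>, the coefficients of \<open>u\<close> would have sum 1 over the ends of each edge, in contradiction to
  \<open>odd_cycle_alternating_sum\<close>.
\<close>

lemma torsion_of_odd_cycle_plus:
  assumes m1: "m = 1" and cyc: "is_cycle (state_graph D s\<^sub>0) vs es" and len: "odd (length es)"
  shows "has_Z2_torsion (khovanov_homology D (m * (N - 2)) J)"
proof (rule khovanov_homology_has_Z2_torsion[OF D])
  have deg: "m * (N - 2) - 2 = m * (N - 4)" "m * (N - 2) + 2 = m * N" "m * N - 2 = m * (N - 2)"
    using m1 by simp_all
  let ?E = "generators D (m * (N - 2)) J" and ?V = "generators D (m * N) J"
  let ?x = "\<Sum>S\<in>?E. frag_of S" and ?y = "\<Sum>S\<in>?V. frag_of S"
  note lookup_x = lookup_sum_frag_of[OF finite_generators[OF D], of "m * (N - 2)" J]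
  note lookup_y = lookup_sum_frag_of[OF finite_generators[OF D], of "m * N" J]
  show keys_x: "Poly_Mapping.keys ?x \<subseteq> ?E"
    by (auto simp: in_keys_iff lookup_x)
  have keys_y: "Poly_Mapping.keys ?y \<subseteq> ?V"
    by (auto simp: in_keys_iff lookup_y)
  then show "Poly_Mapping.keys ?y \<subseteq> generators D (m * (N - 2) + 2) J" by (simp only: deg)
  show "differential D (m * (N - 2)) J ?x = 0"
  proof (rule poly_mapping_eqI)
    fix Z
    have "(\<Sum>S\<in>?E. Poly_Mapping.lookup ?x S * boundary_coeff D S Z) = 0"
      if Z: "Z \<in> generators D (m * (N - 4)) J"
    proof -
      obtain a b where ab: "a \<in> crossings D" "b \<in> crossings D" "a \<noteq> b"
        and Z_eq: "Z = uniform D (s\<^sub>0(a := -m, b := -m)) m"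
        using Z by (rule two_flip_generators)
      have "(\<Sum>S\<in>?E. Poly_Mapping.lookup ?x S * boundary_coeff D S Z) = (\<Sum>S\<in>?E. boundary_coeff D S Z)"
        by (rule sum.cong) (simp_all add: lookup_x)
      also have "\<dots> = (\<Sum>c\<in>crossings D. boundary_coeff D (edge_gen D m c) Z)"
        unfolding edge_generators by (simp add: sum.reindex[OF inj_edge_gen])
      also have "\<dots> = (\<Sum>c\<in>{a, b}. boundary_coeff D (edge_gen D m c) Z)"
        using finite_crossings[OF D] ab incidence_edge_other[OF ab]
        by (intro sum.mono_neutral_right) (auto simp: boundary_coeff_def Z_eq)
      also have "\<dots> = 0"
        using boundary_edge_two_flip[OF m1 ab] boundary_edge_two_flip[OF m1 ab(2,1)] ab(3)
        by (auto simp: Z_eq fun_upd_twist[of b a])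
      finally show ?thesis .
    qed
    then show "Poly_Mapping.lookup (differential D (m * (N - 2)) J ?x) Z = Poly_Mapping.lookup 0 Z"
      unfolding lookup_differential[OF D keys_x] deg by simp
  qed
  have coefficient: "Poly_Mapping.lookup (differential D (m * N) J u) (edge_gen D m c)
      = (\<Sum>v\<in>touching D s\<^sub>0 c. Poly_Mapping.lookup u (vertex_gen D m v))"
    if "c \<in> crossings D" "Poly_Mapping.keys u \<subseteq> ?V" for c u
  proof -
    have "edge_gen D m c \<in> ?E" using that(1) by (simp add: edge_generators)
    then have "Poly_Mapping.lookup (differential D (m * N) J u) (edge_gen D m c)
        = (\<Sum>S\<in>?V. Poly_Mapping.lookup u S * boundary_coeff D S (edge_gen D m c))"
      by (simp only: lookup_differential[OF D that(2)] deg if_True)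
    also have "\<dots> = (\<Sum>v\<in>circles D s\<^sub>0. Poly_Mapping.lookup u (vertex_gen D m v)
        * boundary_coeff D (vertex_gen D m v) (edge_gen D m c))"
      unfolding vertex_generators by (simp add: sum.reindex[OF inj_vertex_gen])
    also have "\<dots> = (\<Sum>v\<in>circles D s\<^sub>0. Poly_Mapping.lookup u (vertex_gen D m v)
        * of_bool (v \<in> touching D s\<^sub>0 c))"
      by (rule sum.cong) (simp_all add: boundary_vertex_edge[OF m1 that(1)])
    also have "\<dots> = (\<Sum>v\<in>touching D s\<^sub>0 c. Poly_Mapping.lookup u (vertex_gen D m v))"
      by (rule sum_touching)
    finally show ?thesis .
  qed
  have "differential D (m * N) J ?y = ?x + ?x"
  proof (rule poly_mapping_eqI)
    fix S
    show "Poly_Mapping.lookup (differential D (m * N) J ?y) S = Poly_Mapping.lookup (?x + ?x) S"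
    proof (cases "S \<in> ?E")
      case True
      then obtain c where c: "c \<in> crossings D" "S = edge_gen D m c" by (auto simp: edge_generators)
      have "Poly_Mapping.lookup (differential D (m * N) J ?y) S
          = (\<Sum>v\<in>touching D s\<^sub>0 c. 1)"
        unfolding c(2) coefficient[OF c(1) keys_y]
      proof (rule sum.cong[OF refl])
        fix v assume "v \<in> touching D s\<^sub>0 c"
        then have "vertex_gen D m v \<in> ?V" using touching_subset by (auto simp: vertex_generators)
        then show "Poly_Mapping.lookup ?y (vertex_gen D m v) = 1" by (simp add: lookup_y)
      qed
      also have "\<dots> = 2" using adequate[OF c(1)] by simp
      finally show ?thesis using True by (simp add: lookup_add lookup_x)
    next
      case False
      then show ?thesis
        unfolding lookup_differential[OF D keys_y] deg by (simp add: lookup_add lookup_x)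
    qed
  qed
  then show "differential D (m * (N - 2) + 2) J ?y = ?x + ?x" by (simp only: deg)
  fix u :: "'c enhanced_state \<Rightarrow>\<^sub>0 int"
  assume "Poly_Mapping.keys u \<subseteq> generators D (m * (N - 2) + 2) J"
  then have u: "Poly_Mapping.keys u \<subseteq> ?V" by (simp only: deg)
  show "differential D (m * (N - 2) + 2) J u \<noteq> ?x"
  proof
    assume "differential D (m * (N - 2) + 2) J u = ?x"
    then have du: "differential D (m * N) J u = ?x" by (simp only: deg)
    define f where "f v = Poly_Mapping.lookup u (vertex_gen D m v)" for v
    have edge: "sum f (touching D s\<^sub>0 c) = 1" if "c \<in> crossings D" for c
    proof -
      have "edge_gen D m c \<in> ?E" using that by (simp add: edge_generators)
      then show ?thesis using coefficient[OF that u] unfolding du f_def lookup_x by simp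
    qed
    have "es ! i \<in> crossings D" if "i < length es" for i
      using cyc nth_mem[OF that] unfolding is_cycle_def edges_state_graph by blast
    then have "(\<Sum>i<length es. (-1) ^ i * sum f (ends (state_graph D s\<^sub>0) (es ! i)))
        = (\<Sum>i<length es. (-1) ^ i)"
      by (intro sum.cong) (simp_all add: ends_state_graph edge)
    then have "(\<Sum>i<length es. (-1) ^ i) = 2 * f (vs ! 0)"
      using odd_cycle_alternating_sum[OF cyc len, of f] adequate
      by (simp add: ends_state_graph edges_state_graph)
    moreover have "(\<Sum>i<k. (-1 :: int) ^ i) = of_bool (odd k)" for k by (induction k) auto
    ultimately show False using len by (simp, presburger)
  qed
qed

text \<open>
  All markers are already negative.
\<close>

lemma no_generators_below:
  assumes "m = -1"
  shows "generators D (m * N - 2) J = {}"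
proof -
  have ge: "sigma D s \<ge> - N" for s
    using card_mono[of "crossings D" "{c \<in> crossings D. s c = -1}"] finite_crossings[OF D]
    by (auto simp: sigma_def)
  have "sigma D s \<noteq> m * N - 2" for s
    using ge[of s] unfolding assms by linarith
  then show ?thesis by (auto simp: generators_def)
qed

text \<open>
  For \<open>m = -1\<close> the differential goes from the edges to the vertices and sends an edge, up to sign, to the
  sum of its two ends.  Every vertex is a cycle.  Let \<open>x\<close> be the initial vertex of the odd cycle and \<open>y\<close>
  the alternating sum of the edges of the cycle; by \<open>odd_cycle_alternating_sum\<close> the boundary of \<open>y\<close> is
  \<open>2 x\<close>.  Boundaries have an even coefficient sum because each edge has two ends, so \<open>x\<close> is not a boundary.
\<close>

lemma torsion_of_odd_cycle_minus:
  assumes m1: "m = -1" and cyc: "is_cycle (state_graph D s\<^sub>0) vs es" and len: "odd (length es)"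
  shows "has_Z2_torsion (khovanov_homology D (m * N) J)"
proof (rule khovanov_homology_has_Z2_torsion[OF D])
  have deg: "m * N + 2 = m * (N - 2)" "m * (N - 2) - 2 = m * N"
    using m1 by simp_all
  let ?E = "generators D (m * (N - 2)) J" and ?V = "generators D (m * N) J"
  have v\<^sub>0: "vs ! 0 \<in> circles D s\<^sub>0"
  proof -
    have "vs ! 0 \<in> set vs" using cyc by (intro nth_mem) (auto simp: is_cycle_def)
    then show ?thesis using cyc by (auto simp: is_cycle_def state_graph_def)
  qed
  have es: "es ! i \<in> crossings D" if "i < length es" for i
    using cyc nth_mem[OF that] unfolding is_cycle_def edges_state_graph by blast
  let ?x = "frag_of (vertex_gen D m (vs ! 0))"
  let ?y = "\<Sum>i<length es. frag_cmul ((-1) ^ i * edge_sign (es ! i)) (frag_of (edge_gen D m (es ! i)))"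
  show keys_x: "Poly_Mapping.keys ?x \<subseteq> ?V" using v\<^sub>0 by (simp add: vertex_generators)
  show "differential D (m * N) J ?x = 0"
    by (rule poly_mapping_eqI) (simp add: lookup_differential[OF D keys_x] no_generators_below[OF m1])
  have edge_in: "edge_gen D m c \<in> ?E" if "c \<in> crossings D" for c
    using that by (simp add: edge_generators)
  have "Poly_Mapping.keys ?y \<subseteq> ?E"
  proof -
    have "frag_cmul k (frag_of (edge_gen D m (es ! i))) \<in> carrier (free_Abelian_group ?E)"
      if "i < length es" for i k
      using keys_cmul[of k "frag_of (edge_gen D m (es ! i))"] edge_in[OF es[OF that]] by auto
    then have "?y \<in> carrier (free_Abelian_group ?E)"
      by (intro sum_closed_free_Abelian_group) auto
    then show ?thesis by simp
  qed
  then show "Poly_Mapping.keys ?y \<subseteq> generators D (m * N + 2) J" by (simp only: deg)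
  have coefficient: "Poly_Mapping.lookup (differential D (m * (N - 2)) J (frag_of (edge_gen D m c)))
      (vertex_gen D m v) = edge_sign c * of_bool (v \<in> touching D s\<^sub>0 c)"
    if "c \<in> crossings D" "v \<in> circles D s\<^sub>0" for c v
  proof -
    have "vertex_gen D m v \<in> ?V" using that(2) by (simp add: vertex_generators)
    moreover have "Poly_Mapping.keys (frag_of (edge_gen D m c)) \<subseteq> ?E" using edge_in[OF that(1)] by simp
    ultimately have "Poly_Mapping.lookup (differential D (m * (N - 2)) J (frag_of (edge_gen D m c)))
        (vertex_gen D m v)
      = (\<Sum>S\<in>?E. Poly_Mapping.lookup (frag_of (edge_gen D m c)) S * boundary_coeff D S (vertex_gen D m v))"
      by (simp only: lookup_differential[OF D] deg if_True)
    also have "\<dots> = (\<Sum>S\<in>?E. if S = edge_gen D m c then boundary_coeff D S (vertex_gen D m v) else 0)"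
      by (rule sum.cong) auto
    also have "\<dots> = boundary_coeff D (edge_gen D m c) (vertex_gen D m v)"
      using edge_in[OF that(1)] finite_generators[OF D] by (simp add: sum.delta)
    finally show ?thesis using boundary_edge_vertex[OF that] by simp
  qed
  have "differential D (m * (N - 2)) J ?y = ?x + ?x"
  proof (rule poly_mapping_eqI)
    fix S
    have linear: "differential D (m * (N - 2)) J ?y = (\<Sum>i<length es. frag_cmul ((-1) ^ i * edge_sign (es ! i))
        (differential D (m * (N - 2)) J (frag_of (edge_gen D m (es ! i)))))"
      unfolding differential_def by (simp add: frag_extend_sum frag_extend_cmul o_def del: frag_extend_of)
    show "Poly_Mapping.lookup (differential D (m * (N - 2)) J ?y) S = Poly_Mapping.lookup (?x + ?x) S"
    proof (cases "S \<in> ?V")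
      case True
      then obtain v where v: "v \<in> circles D s\<^sub>0" "S = vertex_gen D m v" by (auto simp: vertex_generators)
      define f :: "'c circle \<Rightarrow> int" where "f w = of_bool (w = v)" for w
      have "Poly_Mapping.lookup (differential D (m * (N - 2)) J ?y) S
          = (\<Sum>i<length es. (-1) ^ i * sum f (ends (state_graph D s\<^sub>0) (es ! i)))"
        unfolding linear lookup_sum lookup_frag_cmul
      proof (rule sum.cong)
        fix i assume "i \<in> {..<length es}"
        then have c: "es ! i \<in> crossings D" using es by simp
        have "finite (touching D s\<^sub>0 (es ! i))" by (rule finite_touching[OF D])
        then have "sum f (touching D s\<^sub>0 (es ! i)) = of_bool (v \<in> touching D s\<^sub>0 (es ! i))"
          by (simp add: f_def of_bool_def sum.delta)
        then show "(-1) ^ i * edge_sign (es ! i) *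
            Poly_Mapping.lookup (differential D (m * (N - 2)) J (frag_of (edge_gen D m (es ! i)))) S
          = (-1) ^ i * sum f (ends (state_graph D s\<^sub>0) (es ! i))"
          unfolding v(2) coefficient[OF c v(1)] ends_state_graph
          using edge_sign_sq[of "es ! i"] by (simp add: mult.assoc flip: mult.assoc[of "edge_sign _"])
      qed simp
      also have "\<dots> = 2 * f (vs ! 0)"
        using odd_cycle_alternating_sum[OF cyc len, of f] adequate
        by (simp add: ends_state_graph edges_state_graph)
      also have "\<dots> = Poly_Mapping.lookup (?x + ?x) S"
        using inj_onD[OF inj_vertex_gen _ v(1) v\<^sub>0] by (auto simp: lookup_add f_def v(2))
      finally show ?thesis .
    next
      case False
      then have "S \<noteq> vertex_gen D m (vs ! 0)" using keys_x by auto
      moreover have "Poly_Mapping.lookup (differential D (m * (N - 2)) J ?y) S = 0"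
        using \<open>Poly_Mapping.keys ?y \<subseteq> ?E\<close> False by (simp only: lookup_differential[OF D] deg if_False)
      ultimately show ?thesis by (simp add: lookup_add)
    qed
  qed
  then show "differential D (m * N + 2) J ?y = ?x + ?x" by (simp only: deg)
  fix u :: "'c enhanced_state \<Rightarrow>\<^sub>0 int"
  assume "Poly_Mapping.keys u \<subseteq> generators D (m * N + 2) J"
  then have u: "Poly_Mapping.keys u \<subseteq> ?E" by (simp only: deg)
  show "differential D (m * N + 2) J u \<noteq> ?x"
  proof
    assume "differential D (m * N + 2) J u = ?x"
    then have du: "differential D (m * (N - 2)) J u = ?x" by (simp only: deg)
    \<comment> \<open>The coefficient sum of a boundary is even: exchange the summations and sum each column first.\<close>
    have column: "(\<Sum>T\<in>?V. boundary_coeff D S T) = 2 * edge_sign c"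
      if "c \<in> crossings D" "S = edge_gen D m c" for S c
    proof -
      have "(\<Sum>T\<in>?V. boundary_coeff D S T) = (\<Sum>v\<in>circles D s\<^sub>0. boundary_coeff D S (vertex_gen D m v))"
        unfolding vertex_generators by (simp add: sum.reindex[OF inj_vertex_gen])
      also have "\<dots> = (\<Sum>v\<in>circles D s\<^sub>0. edge_sign c * of_bool (v \<in> touching D s\<^sub>0 c))"
        by (rule sum.cong) (simp_all add: that boundary_edge_vertex)
      also have "\<dots> = 2 * edge_sign c"
        unfolding sum_touching using adequate[OF that(1)] by simp
      finally show ?thesis .
    qed
    have "(\<Sum>T\<in>?V. Poly_Mapping.lookup ?x T)
        = (\<Sum>T\<in>?V. \<Sum>S\<in>?E. Poly_Mapping.lookup u S * boundary_coeff D S T)"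
      unfolding du[symmetric] lookup_differential[OF D u] deg by (rule sum.cong) simp_all
    also have "\<dots> = (\<Sum>S\<in>?E. Poly_Mapping.lookup u S * (\<Sum>T\<in>?V. boundary_coeff D S T))"
      unfolding sum_distrib_left by (rule sum.swap)
    also have "even \<dots>"
    proof (rule dvd_sum)
      fix S assume "S \<in> ?E"
      then obtain c where "c \<in> crossings D" "S = edge_gen D m c" by (auto simp: edge_generators)
      then show "even (Poly_Mapping.lookup u S * (\<Sum>T\<in>?V. boundary_coeff D S T))"
        by (simp add: column)
    qed
    finally have "even (\<Sum>T\<in>?V. Poly_Mapping.lookup ?x T)" .
    moreover have "(\<Sum>T\<in>?V. Poly_Mapping.lookup ?x T) = 1"
      using finite_generators[OF D] keys_x by simp
    ultimately show False by simp
  qed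
qed

end

theorem theorem2p2:
  fixes D :: "('c :: linorder) diagram" and N :: int
  assumes "link_diagram D" and "N = int (card (crossings D))"
  shows "(plus_adequate D \<and> has_odd_cycle (state_graph D (state_plus D)) \<longrightarrow>
            has_Z2_torsion
              (khovanov_homology D (N - 2) (N + 2 * int (card (circles D (state_plus D))) - 4))) \<and>
         (minus_adequate D \<and> has_odd_cycle (state_graph D (state_minus D)) \<longrightarrow>
            has_Z2_torsion
              (khovanov_homology D (- N) (- N - 2 * int (card (circles D (state_minus D))) + 4)))"
proof (intro conjI impI; elim conjE)
  have const: "state_plus D = const_state D 1" "state_minus D = const_state D (-1)"
    by (simp_all add: state_plus_def state_minus_def const_state_def)
  {
    assume "plus_adequate D" and odd_cycle: "has_odd_cycle (state_graph D (state_plus D))"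
    then interpret adequate_diagram D 1
      using assms(1) card_touching_eq_2[OF assms(1)]
      by unfold_locales (auto simp: plus_adequate_def const)
    from odd_cycle obtain vs es where "is_cycle (state_graph D (const_state D 1)) vs es" "odd (length es)"
      by (auto simp: has_odd_cycle_def const)
    from torsion_of_odd_cycle_plus[OF refl this]
    show "has_Z2_torsion
        (khovanov_homology D (N - 2) (N + 2 * int (card (circles D (state_plus D))) - 4))"
      by (simp add: const assms(2))
  next
    assume "minus_adequate D" and odd_cycle: "has_odd_cycle (state_graph D (state_minus D))"
    then interpret adequate_diagram D "-1"
      using assms(1) card_touching_eq_2[OF assms(1)]
      by unfold_locales (auto simp: minus_adequate_def const)
    from odd_cycle obtain vs es where "is_cycle (state_graph D (const_state D (-1))) vs es" "odd (length es)"
      by (auto simp: has_odd_cycle_def const)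
    from torsion_of_odd_cycle_minus[OF refl this]
    show "has_Z2_torsion
        (khovanov_homology D (- N) (- N - 2 * int (card (circles D (state_minus D))) + 4))"
      by (simp add: const assms(2) algebra_simps)
  }
qed

end
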